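(* Let $\Phi:\mathbf{R}^n\to\mathbf{R}^m$ be continuously differentiable, let $x^{k+1}=x^k+\alpha_k d^k$ ($k=0,1,2,\ldots$) with step sizes $\alpha_k>0$, and let the search directions be given by $$d^k=\begin{cases}\vartheta(x^k), & k=0,\\[1mm] \vartheta(x^k)+\beta_k^{PRP+}d^{k-1}-\beta_k^{PRP+}\dfrac{|\lambda(x^k,d^{k-1})|}{\lambda(x^k,\vartheta(x^k))}\,\vartheta(x^k), & k\ge 1,\end{cases}$$ where $$\beta_k^{PRP+}=\max\left\{0,\ \frac{-\lambda(x^k,\vartheta(x^k))+\lambda(x^{k-1},\vartheta(x^k))}{-\lambda(x^{k-1},\vartheta(x^{k-1}))}\right\}.$$ If $x^k$ is not $E$-Pareto critical for $\Phi$, then $d^k$ satisfies the sufficient descent condition with constant $h=1$, that is, $$\lambda(x^k,d^k)\le \lambda(x^k,\vartheta(x^k)).$$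
   Context: $E\subset\mathbf{R}^m$ is a closed, convex and pointed cone with nonempty interior $\mathrm{int}(E)$. The dual cone is $E^*=\{v\in\mathbf{R}^m:\langle v,z\rangle\ge 0\ \ \forall z\in E\}$. $V\subset E^*\setminus\{0\}$ is a fixed compact set with $\mathrm{cone}(\mathrm{co}(V))=E^*$, where $\mathrm{co}$ denotes the convex hull and $\mathrm{cone}(\cdot)$ the generated cone (e.g. $V=\{v\in E^*:\|v\|=1\}$ for general $E$, or the canonical basis of $\mathbf{R}^m$ if $E=\mathbf{R}^m_+$). $J\Phi(u)$ denotes the Jacobian of $\Phi$ at $u$. A point $u\in\mathbf{R}^n$ is $E$-Pareto critical for $\Phi$ if $-\mathrm{int}(E)\cap\{J\Phi(u)d:d\in\mathbf{R}^n\}=\emptyset$. For $u,d\in\mathbf{R}^n$, define $\lambda(u,d)=\sup\{\langle J\Phi(u)d,v\rangle:v\in V\}$, and let $$\vartheta(u)=\arg\min_{d\in\mathbf{R}^n}\ \lambda(u,d)+\tfrac12\|d\|^2,$$ which exists and is unique. The sufficient descent condition with constant $h\in(0,1]$ is $\lambda(x^k,d^k)\le h\,\lambda(x^k,\vartheta(x^k))$. The formula for $d^k$ with $k\ge1$ is understood for iterates at which its denominators are nonzero (the iteration is continued only from points that are not $E$-Pareto critical). *)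

theory Defs
  imports "HOL-Analysis.Analysis"
begin

definition pointed :: "'a::real_vector set \<Rightarrow> bool" where
  "pointed E \<longleftrightarrow> E \<inter> uminus ` E = {0}"

definition dual_cone :: "'a::real_inner set \<Rightarrow> 'a set" where
  "dual_cone E = {v. \<forall>z\<in>E. 0 \<le> v \<bullet> z}"

definition continuously_differentiable :: "(real^'n \<Rightarrow> real^'m) \<Rightarrow> bool" where
  "continuously_differentiable \<Phi> \<longleftrightarrow>
     (\<forall>u. \<Phi> differentiable (at u)) \<and> continuous_on UNIV (\<lambda>u. jacobian \<Phi> (at u))"

definition pareto_critical ::
  "(real^'m) set \<Rightarrow> (real^'n \<Rightarrow> real^'m) \<Rightarrow> real^'n \<Rightarrow> bool" where
  "pareto_critical E \<Phi> u \<longleftrightarrow>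
     uminus ` interior E \<inter> range (\<lambda>d. jacobian \<Phi> (at u) *v d) = {}"

definition lam ::
  "(real^'m) set \<Rightarrow> (real^'n \<Rightarrow> real^'m) \<Rightarrow> real^'n \<Rightarrow> real^'n \<Rightarrow> real" where
  "lam V \<Phi> u d = (SUP v\<in>V. (jacobian \<Phi> (at u) *v d) \<bullet> v)"

text \<open>The minimiser below exists and is unique when V is compact and nonempty, so the
  choice made by \<^const>\<open>arg_min\<close> is immaterial.\<close>

definition theta :: "(real^'m) set \<Rightarrow> (real^'n \<Rightarrow> real^'m) \<Rightarrow> real^'n \<Rightarrow> real^'n" where
  "theta V \<Phi> u = (ARG_MIN (\<lambda>d. lam V \<Phi> u d + 1/2 * (norm d)\<^sup>2) d. True)"

text \<open>Here u is the current and w the previous iterate; the denominator vanishes only if w is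
  Pareto critical, and then the value is 0 by the convention for division by zero.\<close>

definition beta_PRP_plus ::
  "(real^'m) set \<Rightarrow> (real^'n \<Rightarrow> real^'m) \<Rightarrow> real^'n \<Rightarrow> real^'n \<Rightarrow> real" where
  "beta_PRP_plus V \<Phi> w u =
     max 0 ((- lam V \<Phi> u (theta V \<Phi> u) + lam V \<Phi> w (theta V \<Phi> u))
            / (- lam V \<Phi> w (theta V \<Phi> w)))"

definition sufficient_descent ::
  "(real^'m) set \<Rightarrow> (real^'n \<Rightarrow> real^'m) \<Rightarrow> real \<Rightarrow> real^'n \<Rightarrow> real^'n \<Rightarrow> bool" where
  "sufficient_descent V \<Phi> h u d \<longleftrightarrow> lam V \<Phi> u d \<le> h * lam V \<Phi> u (theta V \<Phi> u)"

end

theory Submission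
  imports Defs
begin

text \<open>The function \<open>lam V \<Phi> u\<close> is the support function of the compact set \<open>V\<close> composed with
  the linear map \<open>J \<Phi> u\<close>, hence sublinear. Two facts about the current iterate then give the result.

  \<^item> If \<open>u\<close> is not critical, the steepest descent value \<open>L = lam V \<Phi> u (theta V \<Phi> u)\<close> is negative.
    Indeed some \<open>d\<close> has \<open>- J \<Phi> u d\<close> in the interior of \<open>E\<close>, where all elements of \<open>V\<close> are strictly
    positive; by compactness \<open>lam V \<Phi> u d < 0\<close>. Along a short enough multiple of \<open>d\<close> the linear
    decrease beats the quadratic penalty, so the minimal value defining \<open>theta\<close> is negative, and
    with it \<open>L\<close> (\<open>lam_theta_neg\<close>). The argument needs the minimum to be attained, since \<open>theta\<close>
    is a choice of minimiser; it is, because a sublinear function on a Euclidean space is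
    continuous and decreases at most linearly (\<open>sublinear_plus_square_has_minimiser\<close>).

  \<^item> Write \<open>b \<ge> 0\<close> for the conjugacy parameter and \<open>p\<close> for \<open>lam\<close> at the previous direction. As
    \<open>L < 0\<close>, the new direction is \<open>b\<close> times the previous one plus \<open>1 - b * \<bar>p\<bar> / L \<ge> 1\<close> times
    \<open>theta\<close>. Sublinearity bounds its \<open>lam\<close> by \<open>L - b * \<bar>p\<bar> + b * p \<le> L\<close>
    (\<open>sublinear_corrected_direction\<close>): the correction term absorbs exactly what the previous
    direction may add.\<close>

section \<open>Sublinear functions\<close>

definition sublinear :: "('a::real_vector \<Rightarrow> real) \<Rightarrow> bool" where
  "sublinear f \<longleftrightarrow>
     (\<forall>x y. f (x + y) \<le> f x + f y) \<and> (\<forall>c x. 0 \<le> c \<longrightarrow> f (c *\<^sub>R x) = c * f x)"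

lemma sublinearD:
  assumes "sublinear f"
  shows sublinear_add: "f (x + y) \<le> f x + f y"
    and sublinear_scaleR: "0 \<le> c \<Longrightarrow> f (c *\<^sub>R x) = c * f x"
  using assms by (auto simp: sublinear_def)

lemma sublinear_zero:
  assumes "sublinear f"
  shows "f 0 = 0"
  using sublinear_scaleR[OF assms, of 0 0] by simp

lemma sublinear_continuous:
  fixes f :: "'a::euclidean_space \<Rightarrow> real"
  assumes "sublinear f"
  shows "continuous_on S f"
proof -
  have "convex_on UNIV f"
  proof (rule convex_onI)
    fix t x y assume "0 < t" "t < (1::real)"
    then show "f ((1 - t) *\<^sub>R x + t *\<^sub>R y) \<le> (1 - t) * f x + t * f y"
      using sublinear_add[OF assms, of "(1 - t) *\<^sub>R x" "t *\<^sub>R y"]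
      by (simp add: sublinear_scaleR[OF assms])
  qed simp
  then have "continuous_on UNIV f"
    by (rule convex_on_continuous[OF open_UNIV])
  then show ?thesis
    by (rule continuous_on_subset) simp
qed

text \<open>On the unit ball a continuous function is bounded below; homogeneity carries the bound to
  all vectors, scaled by the norm.\<close>

lemma sublinear_lower_bound:
  fixes f :: "'a::euclidean_space \<Rightarrow> real"
  assumes "sublinear f"
  obtains K where "0 \<le> K" and "\<And>x. - K * norm x \<le> f x"
proof -
  have "\<exists>z\<in>cball 0 1. \<forall>y\<in>cball 0 1. f z \<le> f y"
    by (intro continuous_attains_inf sublinear_continuous assms) auto
  then obtain z where "\<forall>y\<in>cball 0 1. f z \<le> f y" by blast
  then have z: "f z \<le> f y" if "norm y \<le> 1" for y using that by simp
  have "- \<bar>f z\<bar> * norm x \<le> f x" for x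
  proof (cases "x = 0")
    case False
    have "f z \<le> f ((1 / norm x) *\<^sub>R x)" by (rule z) (use False in simp)
    also have "\<dots> = f x / norm x" by (subst sublinear_scaleR[OF assms]) auto
    finally have "f z * norm x \<le> f x" using False by (simp add: field_simps)
    moreover have "- \<bar>f z\<bar> * norm x \<le> f z * norm x"
      by (rule mult_right_mono) auto
    ultimately show ?thesis by linarith
  qed (simp add: sublinear_zero[OF assms])
  then show ?thesis using that[of "\<bar>f z\<bar>"] by simp
qed

text \<open>If \<open>f x \<ge> - K * norm x\<close>, then outside the ball of radius \<open>2 * K\<close> the objective is
  nonnegative, hence no smaller than at the origin; a minimiser on that ball is a global one.\<close>

lemma sublinear_plus_square_has_minimiser:
  fixes f :: "'a::euclidean_space \<Rightarrow> real"
  assumes "sublinear f"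
  obtains z where "\<And>x. f z + 1/2 * (norm z)\<^sup>2 \<le> f x + 1/2 * (norm x)\<^sup>2"
proof -
  let ?g = "\<lambda>x. f x + 1/2 * (norm x)\<^sup>2"
  obtain K where K: "0 \<le> K" "\<And>x. - K * norm x \<le> f x"
    using sublinear_lower_bound[OF assms] by blast
  have "\<exists>z\<in>cball 0 (2 * K). \<forall>y\<in>cball 0 (2 * K). ?g z \<le> ?g y"
    by (intro continuous_attains_inf continuous_intros sublinear_continuous assms) (use K in auto)
  then obtain z where "\<forall>y\<in>cball 0 (2 * K). ?g z \<le> ?g y" by blast
  then have z: "?g z \<le> ?g y" if "norm y \<le> 2 * K" for y using that by simp
  have "?g z \<le> ?g x" for x
  proof (cases "norm x \<le> 2 * K")
    case False
    have "?g z \<le> 0" using z[of 0] K by (simp add: sublinear_zero[OF assms])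
    also have "0 \<le> norm x * (norm x / 2 - K)" using False K by (intro mult_nonneg_nonneg) auto
    also have "\<dots> \<le> ?g x" using K(2)[of x] by (simp add: power2_eq_square algebra_simps)
    finally show ?thesis .
  qed (rule z)
  then show ?thesis by (rule that)
qed

lemma sublinear_plus_square_neg_value:
  assumes "sublinear f" and "f d < 0"
  obtains x where "f x + 1/2 * (norm x)\<^sup>2 < 0"
proof -
  \<comment> \<open>The value at \<open>t *\<^sub>R d\<close> is \<open>t * (f d + t * (norm d)\<^sup>2 / 2)\<close>. Its minimiser
    \<open>- f d / (norm d)\<^sup>2\<close> is perturbed by 1 in the denominator to avoid division by zero.\<close>
  define t where "t = - f d / ((norm d)\<^sup>2 + 1)"
  have pos: "0 < (norm d)\<^sup>2 + 1" by (simp add: add_nonneg_pos)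
  then have t: "0 < t" using assms(2) by (simp add: t_def divide_neg_pos)
  have "t * ((norm d)\<^sup>2 + 1) = - f d" using pos by (simp add: t_def)
  then have "t * (norm d)\<^sup>2 = - f d - t" by (simp add: algebra_simps)
  then have "f d + t * (norm d)\<^sup>2 / 2 < 0" using t assms(2) by linarith
  then have "t * (f d + t * (norm d)\<^sup>2 / 2) < 0" using t by (simp add: mult_pos_neg)
  moreover have "f (t *\<^sub>R d) + 1/2 * (norm (t *\<^sub>R d))\<^sup>2 = t * (f d + t * (norm d)\<^sup>2 / 2)"
    using t by (simp add: sublinear_scaleR[OF assms(1)] power2_eq_square algebra_simps)
  ultimately show ?thesis using that[of "t *\<^sub>R d"] by simp
qed

text \<open>Because \<open>f y < 0\<close>, the coefficient of \<open>y\<close> is at least 1, so positive homogeneity evaluates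
  \<open>f\<close> on that part exactly: the correction contributes \<open>- b * \<bar>f e\<bar>\<close>, which offsets \<open>b * f e\<close>.\<close>

lemma sublinear_corrected_direction:
  assumes f: "sublinear f" and neg: "f y < 0" and b: "0 \<le> b"
  shows "f (y + b *\<^sub>R e - (b * (\<bar>f e\<bar> / f y)) *\<^sub>R y) \<le> f y"
proof -
  let ?c = "1 - b * (\<bar>f e\<bar> / f y)"
  have "b * (\<bar>f e\<bar> / f y) \<le> 0"
    using neg b by (intro mult_nonneg_nonpos divide_nonneg_neg) auto
  then have c: "0 \<le> ?c" by simp
  have "y + b *\<^sub>R e - (b * (\<bar>f e\<bar> / f y)) *\<^sub>R y = ?c *\<^sub>R y + b *\<^sub>R e"
    by (simp add: algebra_simps)
  also have "f \<dots> \<le> ?c * f y + b * f e"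
    using sublinear_add[OF f, of "?c *\<^sub>R y" "b *\<^sub>R e"]
    by (simp only: sublinear_scaleR[OF f b] sublinear_scaleR[OF f c])
  also have "?c * f y = f y - b * \<bar>f e\<bar>" using neg by (simp add: algebra_simps)
  also have "f y - b * \<bar>f e\<bar> + b * f e \<le> f y"
    using mult_left_mono[OF abs_ge_self b, of "f e"] by simp
  finally show ?thesis .
qed

section \<open>Support functions of compact sets\<close>

lemma bdd_above_inner_image:
  fixes V :: "'a::real_inner set"
  assumes "compact V"
  shows "bdd_above ((\<lambda>v. y \<bullet> v) ` V)"
  by (intro bounded_imp_bdd_above compact_imp_bounded compact_continuous_image
      continuous_intros assms)

lemma sublinear_lam:
  assumes "compact V" and "V \<noteq> {}"
  shows "sublinear (lam V \<Phi> u)"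
  unfolding sublinear_def
proof (intro conjI allI impI)
  let ?J = "jacobian \<Phi> (at u)"
  fix x y
  have "(?J *v (x + y)) \<bullet> v \<le> lam V \<Phi> u x + lam V \<Phi> u y" if "v \<in> V" for v
    unfolding lam_def matrix_vector_right_distrib inner_add_left
    by (intro add_mono cSUP_upper that bdd_above_inner_image assms)
  then show "lam V \<Phi> u (x + y) \<le> lam V \<Phi> u x + lam V \<Phi> u y"
    unfolding lam_def[of V \<Phi> u "x + y"] by (intro cSUP_least assms)
next
  let ?J = "jacobian \<Phi> (at u)"
  fix c :: real and x assume "0 \<le> c"
  have "c * Sup ((\<lambda>v. (?J *v x) \<bullet> v) ` V) = (SUP s\<in>(\<lambda>v. (?J *v x) \<bullet> v) ` V. c * s)"
  proof (rule continuous_at_Sup_mono)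
    show "mono (\<lambda>s. c * s)" using \<open>0 \<le> c\<close> by (simp add: mono_def mult_left_mono)
    show "continuous (at_left (Sup ((\<lambda>v. (?J *v x) \<bullet> v) ` V))) (\<lambda>s. c * s)"
      by (intro continuous_intros)
  qed (use assms bdd_above_inner_image[OF assms(1)] in auto)
  then show "lam V \<Phi> u (c *\<^sub>R x) = c * lam V \<Phi> u x"
    by (simp add: lam_def matrix_vector_mult_scaleR image_image)
qed

section \<open>Strict descent at noncritical points\<close>

text \<open>Moving from the interior point \<open>z\<close> a little in direction \<open>- v\<close> stays in \<open>E\<close>, which costs
  a positive multiple of \<open>v \<bullet> v > 0\<close> but leaves the pairing with \<open>v\<close> nonnegative.\<close>

lemma dual_cone_pos_on_interior:
  fixes E :: "'a::real_inner set"
  assumes v: "v \<in> dual_cone E" "v \<noteq> 0" and z: "z \<in> interior E"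
  shows "0 < v \<bullet> z"
proof -
  obtain e where e: "0 < e" "cball z e \<subseteq> E"
    using z by (auto simp: mem_interior_cball)
  have "z - (e / norm v) *\<^sub>R v \<in> E"
    using e v(2) by (intro subsetD[OF e(2)]) (simp add: dist_norm)
  then have "0 \<le> v \<bullet> (z - (e / norm v) *\<^sub>R v)"
    using v(1) by (auto simp: dual_cone_def)
  moreover have "0 < (e / norm v) * (v \<bullet> v)"
    using e v(2) by simp
  ultimately show ?thesis by (simp add: inner_diff_right)
qed

lemma noncritical_imp_descent_direction:
  assumes "compact V" and "V \<noteq> {}" and "V \<subseteq> dual_cone E - {0}"
    and "\<not> pareto_critical E \<Phi> u"
  obtains d where "lam V \<Phi> u d < 0"
proof -
  let ?J = "jacobian \<Phi> (at u)"
  obtain z d where z: "z \<in> interior E" and d: "?J *v d = - z"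
    using assms(4) unfolding pareto_critical_def by fastforce
  \<comment> \<open>A supremum of negative numbers could be zero; compactness makes it one of them.\<close>
  have "\<exists>w\<in>V. \<forall>v\<in>V. (?J *v d) \<bullet> v \<le> (?J *v d) \<bullet> w"
    by (intro continuous_attains_sup continuous_intros assms)
  then obtain w where w: "w \<in> V" "\<And>v. v \<in> V \<Longrightarrow> (?J *v d) \<bullet> v \<le> (?J *v d) \<bullet> w" by blast
  have "lam V \<Phi> u d \<le> (?J *v d) \<bullet> w"
    unfolding lam_def by (intro cSUP_least assms w)
  also have "\<dots> < 0"
    using dual_cone_pos_on_interior[of w E z] w(1) z assms(3)
    by (auto simp: d inner_commute)
  finally show ?thesis by (rule that)
qed

lemma theta_minimises:
  assumes "compact V" and "V \<noteq> {}"
  shows "lam V \<Phi> u (theta V \<Phi> u) + 1/2 * (norm (theta V \<Phi> u))\<^sup>2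
           \<le> lam V \<Phi> u d + 1/2 * (norm d)\<^sup>2"
proof -
  obtain z where z: "\<And>x. lam V \<Phi> u z + 1/2 * (norm z)\<^sup>2 \<le> lam V \<Phi> u x + 1/2 * (norm x)\<^sup>2"
    using sublinear_plus_square_has_minimiser[OF sublinear_lam[OF assms, of \<Phi> u]] by blast
  show ?thesis
    unfolding theta_def
    by (rule arg_minI[where x = z]) (use z in \<open>auto simp: not_less\<close>)
qed

lemma lam_theta_neg:
  assumes "compact V" and "V \<noteq> {}" and "V \<subseteq> dual_cone E - {0}"
    and "\<not> pareto_critical E \<Phi> u"
  shows "lam V \<Phi> u (theta V \<Phi> u) < 0"
proof -
  obtain d where "lam V \<Phi> u d < 0"
    using noncritical_imp_descent_direction[OF assms] .
  then obtain x where "lam V \<Phi> u x + 1/2 * (norm x)\<^sup>2 < 0"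
    using sublinear_plus_square_neg_value[OF sublinear_lam[OF assms(1,2)]] by blast
  then show ?thesis
    using theta_minimises[OF assms(1,2), of \<Phi> u x] zero_le_power2[of "norm (theta V \<Phi> u)"]
    by linarith
qed

section \<open>Sufficient descent\<close>

theorem theorem3p2:
  fixes E V :: "(real^'m) set"
    and \<Phi> :: "real^'n \<Rightarrow> real^'m"
    and x d :: "nat \<Rightarrow> real^'n"
    and \<alpha> :: "nat \<Rightarrow> real"
  assumes "closed E" and "convex E" and "cone E" and "pointed E" and "interior E \<noteq> {}"
    and "compact V" and "V \<subseteq> dual_cone E - {0}"
    and "cone hull (convex hull V) = dual_cone E"
    and "continuously_differentiable \<Phi>"
    and step: "\<And>k. \<not> pareto_critical E \<Phi> (x k) \<Longrightarrow>
           \<alpha> k > 0 \<and> x (Suc k) = x k + \<alpha> k *\<^sub>R d k"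
    and direction: "\<And>k. \<not> pareto_critical E \<Phi> (x k) \<Longrightarrow>
           d k = (if k = 0 then theta V \<Phi> (x k)
                  else theta V \<Phi> (x k)
                     + beta_PRP_plus V \<Phi> (x (k - 1)) (x k) *\<^sub>R d (k - 1)
                     - (beta_PRP_plus V \<Phi> (x (k - 1)) (x k)
                         * (\<bar>lam V \<Phi> (x k) (d (k - 1))\<bar> / lam V \<Phi> (x k) (theta V \<Phi> (x k))))
                       *\<^sub>R theta V \<Phi> (x k))"
    and "\<not> pareto_critical E \<Phi> (x k)"
  shows "sufficient_descent V \<Phi> 1 (x k) (d k)"
proof -
  let ?L = "lam V \<Phi> (x k) (theta V \<Phi> (x k))"
  \<comment> \<open>The dual cone contains the origin, whereas the empty set generates the empty cone.\<close>
  have "0 \<in> dual_cone E" by (simp add: dual_cone_def)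
  then have "cone hull (convex hull V) \<noteq> {}"
    using \<open>cone hull (convex hull V) = dual_cone E\<close> by blast
  then have "V \<noteq> {}" by (simp add: cone_hull_empty_iff[symmetric])
  note V = \<open>compact V\<close> \<open>V \<noteq> {}\<close>
  have "?L < 0"
    using V \<open>V \<subseteq> dual_cone E - {0}\<close> \<open>\<not> pareto_critical E \<Phi> (x k)\<close> by (rule lam_theta_neg)
  moreover have "0 \<le> beta_PRP_plus V \<Phi> (x (k - 1)) (x k)"
    by (simp add: beta_PRP_plus_def)
  ultimately have "lam V \<Phi> (x k) (d k) \<le> ?L" if "k \<noteq> 0"
    unfolding direction[OF \<open>\<not> pareto_critical E \<Phi> (x k)\<close>] if_not_P[OF that]
    by (intro sublinear_corrected_direction sublinear_lam V)
  moreover have "lam V \<Phi> (x k) (d k) = ?L" if "k = 0"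
    unfolding direction[OF \<open>\<not> pareto_critical E \<Phi> (x k)\<close>] if_P[OF that] ..
  ultimately have "lam V \<Phi> (x k) (d k) \<le> ?L" by fastforce
  then show ?thesis by (simp add: sufficient_descent_def)
qed

end
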